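(* Let $G$ be a (topologically) characteristically simple topological group which is not strongly amenable. Then $G$ acts effectively on its universal minimal proximal flow $\Pi(G)$; that is, if $t\in G$ satisfies $tx=x$ for all $x\in\Pi(G)$, then $t=e$.
   Context: A topological group is a group with a Hausdorff topology such that $(x,y)\mapsto xy^{-1}$ is continuous; $e$ is its neutral element. A flow $(G,X)$ consists of a topological group $G$ and a (nonempty) compact Hausdorff space $X$ with a jointly continuous action $G\times X\to X$, $(t,x)\mapsto tx$. A flow is minimal if every orbit is dense; proximal if for all $x,y\in X$ there is a net $\{t_n\}$ in $G$ with $\lim t_nx=\lim t_ny$. The universal minimal proximal flow $(G,\Pi(G))$ is the minimal proximal flow, unique up to isomorphism, such that every minimal proximal flow $(G,Y)$ is the image of $\Pi(G)$ under a continuous surjective $G$-equivariant map (existence and uniqueness are known). $G$ is strongly amenable if and only if $\Pi(G)$ is a single point. $\mathrm{Aut}(G)$ is the group of topological automorphisms of $G$ and $\mathrm{Aut}(G)t=\{a(t)\mid a\in\mathrm{Aut}(G)\}$. $G$ is (topologically) characteristically simple if for every $t\in G$ with $t\ne e$ the subgroup $\langle\mathrm{Aut}(G)t\rangle$ algebraically generated by $\mathrm{Aut}(G)t$ is dense in $G$. *)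

theory Defs
  imports
    "HOL-Algebra.Group_Action"
    "HOL-Algebra.Generated_Groups"
    "HOL-Analysis.Analysis"
begin

section \<open>Topological groups\<close>

definition topological_group :: "('g, 'm) monoid_scheme \<Rightarrow> 'g topology \<Rightarrow> bool" where
  "topological_group G T \<longleftrightarrow>
     group G \<and> topspace T = carrier G \<and> Hausdorff_space T \<and>
     continuous_map (prod_topology T T) T (\<lambda>(x, y). x \<otimes>\<^bsub>G\<^esub> inv\<^bsub>G\<^esub> y)"

definition topological_auto :: "('g, 'm) monoid_scheme \<Rightarrow> 'g topology \<Rightarrow> ('g \<Rightarrow> 'g) set" where
  "topological_auto G T = {a \<in> auto G. homeomorphic_map T T a}"

definition topologically_characteristically_simple ::
    "('g, 'm) monoid_scheme \<Rightarrow> 'g topology \<Rightarrow> bool" where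
  "topologically_characteristically_simple G T \<longleftrightarrow>
     (\<forall>t\<in>carrier G. t \<noteq> \<one>\<^bsub>G\<^esub> \<longrightarrow>
        T closure_of generate G {a t | a. a \<in> topological_auto G T} = carrier G)"


section \<open>Flows\<close>

definition flow ::
    "('g, 'm) monoid_scheme \<Rightarrow> 'g topology \<Rightarrow> 'x topology \<Rightarrow> ('g \<Rightarrow> 'x \<Rightarrow> 'x) \<Rightarrow> bool" where
  "flow G T X \<phi> \<longleftrightarrow>
     topological_group G T \<and> topspace X \<noteq> {} \<and> compact_space X \<and> Hausdorff_space X \<and>
     group_action G (topspace X) \<phi> \<and>
     continuous_map (prod_topology T X) X (\<lambda>(t, x). \<phi> t x)"

definition minimal_flow ::
    "('g, 'm) monoid_scheme \<Rightarrow> 'g topology \<Rightarrow> 'x topology \<Rightarrow> ('g \<Rightarrow> 'x \<Rightarrow> 'x) \<Rightarrow> bool" where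
  "minimal_flow G T X \<phi> \<longleftrightarrow>
     flow G T X \<phi> \<and> (\<forall>x\<in>topspace X. X closure_of orbit G \<phi> x = topspace X)"

text \<open>Nets in the group are rendered as proper filters containing the carrier: a net
  gives its filter of tails, and conversely a proper filter gives the net of its pointed members.\<close>

definition proximal_flow ::
    "('g, 'm) monoid_scheme \<Rightarrow> 'g topology \<Rightarrow> 'x topology \<Rightarrow> ('g \<Rightarrow> 'x \<Rightarrow> 'x) \<Rightarrow> bool" where
  "proximal_flow G T X \<phi> \<longleftrightarrow>
     flow G T X \<phi> \<and>
     (\<forall>x\<in>topspace X. \<forall>y\<in>topspace X. \<exists>F z.
        F \<noteq> bot \<and> (\<forall>\<^sub>F t in F. t \<in> carrier G) \<and>
        limitin X (\<lambda>t. \<phi> t x) z F \<and> limitin X (\<lambda>t. \<phi> t y) z F)"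

definition minimal_proximal_flow ::
    "('g, 'm) monoid_scheme \<Rightarrow> 'g topology \<Rightarrow> 'x topology \<Rightarrow> ('g \<Rightarrow> 'x \<Rightarrow> 'x) \<Rightarrow> bool" where
  "minimal_proximal_flow G T X \<phi> \<longleftrightarrow> minimal_flow G T X \<phi> \<and> proximal_flow G T X \<phi>"

definition factor_map ::
    "('g, 'm) monoid_scheme \<Rightarrow> 'x topology \<Rightarrow> ('g \<Rightarrow> 'x \<Rightarrow> 'x) \<Rightarrow>
     'y topology \<Rightarrow> ('g \<Rightarrow> 'y \<Rightarrow> 'y) \<Rightarrow> ('x \<Rightarrow> 'y) \<Rightarrow> bool" where
  "factor_map G X \<phi> Y \<psi> f \<longleftrightarrow>
     continuous_map X Y f \<and> f ` topspace X = topspace Y \<and>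
     (\<forall>t\<in>carrier G. \<forall>x\<in>topspace X. f (\<phi> t x) = \<psi> t (f x))"

text \<open>HOL cannot quantify over all types inside a formula, so the flows tested for universality
  are those whose points are sets of subsets of the group. This is no restriction: in a minimal
  flow some orbit is dense, which bounds the cardinality of the space, so every minimal flow, on
  whatever type, has an isomorphic copy of that form. The result
  \<open>universal_minimal_proximal_flow_factor\<close> below states universality for flows on an arbitrary
  type.\<close>

definition universal_minimal_proximal_flow ::
    "('g, 'm) monoid_scheme \<Rightarrow> 'g topology \<Rightarrow> 'x topology \<Rightarrow> ('g \<Rightarrow> 'x \<Rightarrow> 'x) \<Rightarrow> bool" where
  "universal_minimal_proximal_flow G T X \<phi> \<longleftrightarrow>
     minimal_proximal_flow G T X \<phi> \<and>
     (\<forall>(Y :: 'g set set topology) \<psi>. minimal_proximal_flow G T Y \<psi> \<longrightarrow>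
        (\<exists>f. factor_map G X \<phi> Y \<psi> f))"

text \<open>By the same remark the universal minimal proximal flow may be sought on the type
  \<open>'g set set\<close>. As it is unique up to isomorphism, it does not matter
  which copy is asked to be a point.\<close>

definition strongly_amenable :: "('g, 'm) monoid_scheme \<Rightarrow> 'g topology \<Rightarrow> bool" where
  "strongly_amenable G T \<longleftrightarrow>
     (\<exists>(X :: 'g set set topology) \<phi>.
        universal_minimal_proximal_flow G T X \<phi> \<and> (\<exists>x. topspace X = {x}))"


section \<open>Independence of the carrier type\<close>

lemma minimal_flow_inj:
  fixes X :: "'x topology" and G :: "('g, 'm) monoid_scheme"
  assumes "minimal_flow G T X \<phi>"
  shows "\<exists>h :: 'x \<Rightarrow> 'g set set. inj_on h (topspace X)"
proof -
  have "flow G T X \<phi>" using assms by (simp add: minimal_flow_def)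
  then obtain x0 where x0: "x0 \<in> topspace X" and H: "Hausdorff_space X"
    unfolding flow_def by blast
  define h where "h y = {A. A \<subseteq> carrier G \<and> y \<in> X closure_of ((\<lambda>g. \<phi> g x0) ` A)}" for y
  have dense: "X closure_of orbit G \<phi> x0 = topspace X"
    using assms x0 by (simp add: minimal_flow_def)
  have "h y \<noteq> h z" if y: "y \<in> topspace X" and z: "z \<in> topspace X" and "y \<noteq> z" for y z
  proof -
    obtain U V where UV: "openin X U" "openin X V" "y \<in> U" "z \<in> V" "disjnt U V"
      using H y z \<open>y \<noteq> z\<close> unfolding Hausdorff_space_def by meson
    define A where "A = {g \<in> carrier G. \<phi> g x0 \<in> U}"
    have img: "(\<lambda>g. \<phi> g x0) ` A = U \<inter> orbit G \<phi> x0"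
      by (auto simp: A_def orbit_def)
    have "y \<in> X closure_of (U \<inter> orbit G \<phi> x0)"
      using openin_Int_closure_of_subset[OF UV(1), of "orbit G \<phi> x0"] dense y UV(3) by auto
    moreover have "z \<notin> X closure_of (U \<inter> orbit G \<phi> x0)"
      using UV by (auto simp: in_closure_of disjnt_iff)
    moreover have "A \<subseteq> carrier G" by (auto simp: A_def)
    ultimately have "A \<in> h y" "A \<notin> h z"
      by (simp_all add: h_def img)
    then show ?thesis by blast
  qed
  then show ?thesis by (metis inj_onI)
qed

lemma minimal_proximal_flow_transfer:
  fixes X :: "'x topology" and h :: "'x \<Rightarrow> 'y"
  assumes mp: "minimal_proximal_flow G T X \<phi>" and inj: "inj_on h (topspace X)"
  shows "\<exists>Y \<psi> k. minimal_proximal_flow G T (Y :: 'y topology) \<psi> \<and> factor_map G Y \<psi> X \<phi> k"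
proof -
  define S where "S = topspace X"
  define E where "E = h ` S"
  define k where "k = inv_into S h"
  define Y where "Y = pullback_topology E k X"
  define \<psi> where "\<psi> = (\<lambda>g. \<lambda>z\<in>E. h (\<phi> g (k z)))"
  have fl: "flow G T X \<phi>" using mp by (simp add: minimal_proximal_flow_def minimal_flow_def)
  have tg: "topological_group G T" and act: "group_action G S \<phi>"
    and cont: "continuous_map (prod_topology T X) X (\<lambda>(t, x). \<phi> t x)"
    using fl by (auto simp: flow_def S_def)
  have grp: "group G" and TG: "topspace T = carrier G"
    using tg by (auto simp: topological_group_def)
  have kh: "k (h x) = x" if "x \<in> S" for x
    using that inj by (simp add: k_def S_def)
  have hE: "h x \<in> E" if "x \<in> S" for x using that by (simp add: E_def)
  have kS: "k z \<in> S" if "z \<in> E" for z using that kh by (auto simp: E_def)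
  have hk: "h (k z) = z" if "z \<in> E" for z using that kh by (auto simp: E_def)
  have pS: "\<phi> g x \<in> S" if "g \<in> carrier G" "x \<in> S" for g x
    using group_action.surj_prop[OF act that(1)] that(2) by blast
  have topY: "topspace Y = E"
    using kS by (auto simp: Y_def topspace_pullback_topology S_def)
  have ck: "continuous_map Y X k"
    using continuous_map_pullback[OF continuous_map_id, of E k X] by (simp add: Y_def o_def id_def)
  have ch: "continuous_map X Y h"
    unfolding Y_def
  proof (rule continuous_map_pullback')
    show "continuous_map X X (k \<circ> h)"
      by (rule continuous_map_eq[OF continuous_map_id]) (simp add: kh S_def)
    show "topspace X \<subseteq> h -` E"
      using hE by (auto simp: S_def)
  qed
  have hom_maps: "homeomorphic_maps X Y h k"
    unfolding homeomorphic_maps_def using ck ch kh hk topY by (auto simp: S_def)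
  then have hs: "X homeomorphic_space Y" by (auto simp: homeomorphic_space_def)
  have \<psi>h: "\<psi> g (h x) = h (\<phi> g x)" if "x \<in> S" for g x
    using that by (simp add: \<psi>_def kh hE)
  have \<psi>B: "\<psi> g \<in> Bij E" if g: "g \<in> carrier G" for g
  proof -
    have "inj_on (\<psi> g) E"
    proof (rule inj_onI)
      fix u v assume u: "u \<in> E" and v: "v \<in> E" and eq: "\<psi> g u = \<psi> g v"
      have "h (\<phi> g (k u)) = h (\<phi> g (k v))" using eq u v by (simp add: \<psi>_def)
      then have "\<phi> g (k u) = \<phi> g (k v)"
        by (metis kh pS[OF g] kS u v)
      then have "k u = k v"
        using group_action.inj_prop[OF act g] kS u v by (meson inj_onD)
      then show "u = v" by (metis hk u v)
    qed
    moreover have "\<psi> g ` E = E"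
    proof -
      have "\<psi> g ` E = h ` (\<phi> g ` S)"
        by (simp add: E_def image_image \<psi>h)
      then show ?thesis using group_action.surj_prop[OF act g] by (simp add: E_def)
    qed
    ultimately show ?thesis by (simp add: Bij_def bij_betw_def \<psi>_def)
  qed
  have \<psi>act: "group_action G E \<psi>"
    unfolding group_action_def
  proof (rule group_hom.intro[OF grp group_BijGroup group_hom_axioms.intro], rule homI)
    fix g assume "g \<in> carrier G" then show "\<psi> g \<in> carrier (BijGroup E)"
      using \<psi>B by (simp add: BijGroup_def)
  next
    fix g g' assume g: "g \<in> carrier G" "g' \<in> carrier G"
    have "\<psi> (g \<otimes>\<^bsub>G\<^esub> g') z = compose E (\<psi> g) (\<psi> g') z" for z
    proof (cases "z \<in> E")
      case True
      then obtain x where x: "x \<in> S" "z = h x" by (auto simp: E_def)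
      show ?thesis
        using True group_action.composition_rule[OF act x(1) g] x
        by (simp add: compose_def \<psi>h pS g)
    qed (simp add: \<psi>_def compose_def)
    then show "\<psi> (g \<otimes>\<^bsub>G\<^esub> g') = \<psi> g \<otimes>\<^bsub>BijGroup E\<^esub> \<psi> g'"
      using \<psi>B g by (auto simp: BijGroup_def)
  qed
  have \<psi>cont: "continuous_map (prod_topology T Y) Y (\<lambda>(t, z). \<psi> t z)"
  proof -
    have 1: "continuous_map (prod_topology T Y) (prod_topology T X) (\<lambda>(t, z). (t, k z))"
      using ck by (simp add: continuous_map_prod_top)
    have "continuous_map (prod_topology T Y) Y (h \<circ> ((\<lambda>(t, x). \<phi> t x) \<circ> (\<lambda>(t, z). (t, k z))))"
      by (intro continuous_map_compose[OF _ ch] continuous_map_compose[OF 1 cont])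
    then show ?thesis
      by (rule continuous_map_eq) (auto simp: topY \<psi>_def)
  qed
  have flY: "flow G T Y \<psi>"
    unfolding flow_def topY
    using tg fl \<psi>act \<psi>cont hs homeomorphic_compact_space homeomorphic_Hausdorff_space
    by (auto simp: flow_def E_def S_def)
  have orb: "orbit G \<psi> (h x) = h ` orbit G \<phi> x" if "x \<in> S" for x
    using that \<psi>h by (auto simp: orbit_def)
  have hmap: "homeomorphic_map X Y h" using hom_maps homeomorphic_map_maps by blast
  have minY: "minimal_flow G T Y \<psi>"
    unfolding minimal_flow_def
  proof (intro conjI flY ballI)
    fix z assume "z \<in> topspace Y"
    then obtain x where x: "x \<in> S" "z = h x" by (auto simp: E_def topY)
    have sub: "orbit G \<phi> x \<subseteq> topspace X" using pS x by (auto simp: orbit_def S_def)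
    have "Y closure_of (h ` orbit G \<phi> x) = h ` (X closure_of orbit G \<phi> x)"
      by (rule homeomorphic_map_closure_of[OF hmap sub])
    also have "\<dots> = topspace Y"
      using mp x by (simp add: minimal_proximal_flow_def minimal_flow_def topY E_def S_def)
    finally show "Y closure_of orbit G \<psi> z = topspace Y" using orb x by simp
  qed
  have proxY: "proximal_flow G T Y \<psi>"
    unfolding proximal_flow_def
  proof (intro conjI flY ballI)
    fix u v assume "u \<in> topspace Y" "v \<in> topspace Y"
    then obtain x y where x: "x \<in> S" "u = h x" and y: "y \<in> S" "v = h y"
      by (auto simp: E_def topY)
    obtain F z where F: "F \<noteq> bot" "\<forall>\<^sub>F t in F. t \<in> carrier G"
        "limitin X (\<lambda>t. \<phi> t x) z F" "limitin X (\<lambda>t. \<phi> t y) z F"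
      using mp x y unfolding minimal_proximal_flow_def proximal_flow_def S_def by meson
    have "limitin Y (\<lambda>t. \<psi> t (h x)) (h z) F" if "x \<in> S" "limitin X (\<lambda>t. \<phi> t x) z F" for x
      using continuous_map_limit[OF ch that(2)] that(1) by (simp add: o_def \<psi>h)
    then show "\<exists>F z. F \<noteq> bot \<and> (\<forall>\<^sub>F t in F. t \<in> carrier G) \<and>
        limitin Y (\<lambda>t. \<psi> t u) z F \<and> limitin Y (\<lambda>t. \<psi> t v) z F"
      using F x y by blast
  qed
  have "factor_map G Y \<psi> X \<phi> k"
    unfolding factor_map_def
  proof (intro conjI ballI ck)
    show "k ` topspace Y = topspace X" using kh by (force simp: topY E_def S_def)
    fix t z assume t: "t \<in> carrier G" and "z \<in> topspace Y"
    then have z: "z \<in> E" by (simp add: topY)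
    then show "k (\<psi> t z) = \<phi> t (k z)"
      by (simp add: \<psi>_def kh pS[OF t] kS)
  qed
  then show ?thesis
    using minY proxY unfolding minimal_proximal_flow_def by blast
qed

theorem universal_minimal_proximal_flow_factor:
  fixes G :: "('g, 'm) monoid_scheme" and X :: "'x topology" and Y :: "'y topology"
  assumes "universal_minimal_proximal_flow G T X \<phi>" and mp: "minimal_proximal_flow G T Y \<psi>"
  shows "\<exists>f. factor_map G X \<phi> Y \<psi> f"
proof -
  obtain h :: "'y \<Rightarrow> 'g set set" where "inj_on h (topspace Y)"
    using minimal_flow_inj[of G T Y \<psi>] mp by (auto simp: minimal_proximal_flow_def)
  then obtain Z \<theta> k where Z: "minimal_proximal_flow G T (Z :: 'g set set topology) \<theta>"
    and k: "factor_map G Z \<theta> Y \<psi> k"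
    using minimal_proximal_flow_transfer[OF mp, of h] by blast
  obtain f where f: "factor_map G X \<phi> Z \<theta> f"
    using assms(1) Z unfolding universal_minimal_proximal_flow_def by blast
  have "continuous_map X Y (k \<circ> f)"
    using f k by (auto simp: factor_map_def intro: continuous_map_compose)
  moreover have "(\<lambda>x. k (f x)) ` topspace X = topspace Y"
    using f k by (simp add: factor_map_def flip: image_image)
  moreover have "(k \<circ> f) (\<phi> t x) = \<psi> t ((k \<circ> f) x)" if "t \<in> carrier G" "x \<in> topspace X" for t x
  proof -
    have "f x \<in> topspace Z" using f that(2) unfolding factor_map_def by blast
    then show ?thesis using f k that by (simp add: factor_map_def)
  qed
  ultimately have "factor_map G X \<phi> Y \<psi> (k \<circ> f)" by (simp add: factor_map_def o_def)
  then show ?thesis by blast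
qed

end

(* If t acts trivially on the universal flow, then so does a t for every topological automorphism a:
   twisting the action by a gives another minimal proximal flow, which is therefore a factor of the
   universal one. The kernel of the action is a closed subgroup, so by characteristic simplicity it
   is all of G as soon as it is nontrivial; minimality then collapses the flow to a point. *)
theory Submission
  imports Defs
begin

lemma topological_autoD:
  assumes "a \<in> topological_auto G T"
  shows "a \<in> hom G G" "bij_betw a (carrier G) (carrier G)" "homeomorphic_map T T a"
  using assms by (auto simp: topological_auto_def auto_def Bij_def)

text \<open>The twisted action is the homomorphism \<open>\<phi>\<close> into the bijection group
  precomposed with \<open>a\<close>. Joint continuity survives because it is the old action after
  the continuous map \<open>a\<close> \<times> identity.\<close>

lemma flow_twist:
  assumes fl: "flow G T X \<phi>" and a: "a \<in> topological_auto G T"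
  shows "flow G T X (\<lambda>g. \<phi> (a g))"
proof -
  note aD = topological_autoD[OF a]
  have act: "group_action G (topspace X) \<phi>"
    and cont: "continuous_map (prod_topology T X) X (\<lambda>(t, x). \<phi> t x)"
    using fl by (auto simp: flow_def)
  interpret group_action G "topspace X" \<phi> by (rule act)
  have "\<phi> \<circ> a \<in> hom G (BijGroup (topspace X))"
    using aD(1) group_hom.homh[OF group_hom] by (rule hom_compose)
  then have "group_action G (topspace X) (\<lambda>g. \<phi> (a g))"
    unfolding group_action_def
    by (intro group_hom.intro group_hom_axioms.intro group_BijGroup group_hom.axioms(1)[OF group_hom]) (simp add: o_def)
  moreover have "continuous_map (prod_topology T X) X (\<lambda>(t, x). \<phi> (a t) x)"
  proof -
    have "continuous_map (prod_topology T X) (prod_topology T X) (\<lambda>(t, x). (a t, x))"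
      using homeomorphic_imp_continuous_map[OF aD(3)] by (simp add: continuous_map_prod_top)
    from continuous_map_compose[OF this cont] show ?thesis
      by (simp add: o_def case_prod_unfold)
  qed
  ultimately show ?thesis using fl by (simp add: flow_def)
qed

text \<open>Since \<open>a\<close> permutes the carrier, twisting only reindexes each orbit, so
  density of orbits is unaffected.\<close>

lemma minimal_flow_twist:
  assumes mf: "minimal_flow G T X \<phi>" and a: "a \<in> topological_auto G T"
  shows "minimal_flow G T X (\<lambda>g. \<phi> (a g))"
proof -
  have "a ` carrier G = carrier G"
    using topological_autoD(2)[OF a] by (rule bij_betw_imp_surj_on)
  then have "orbit G (\<lambda>g. \<phi> (a g)) x = orbit G \<phi> x" for x
    unfolding orbit_def by (metis (no_types, lifting) image_iff)
  then show ?thesis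
    using mf flow_twist[of G T X \<phi>, OF _ a] by (simp add: minimal_flow_def)
qed

text \<open>A filter witnessing proximality of two points for \<open>\<phi>\<close> is pushed
  forward along the inverse of \<open>a\<close>; the twist then undoes the inverse, so the same
  limit is reached.\<close>

lemma proximal_flow_twist:
  assumes pf: "proximal_flow G T X \<phi>" and a: "a \<in> topological_auto G T"
  shows "proximal_flow G T X (\<lambda>g. \<phi> (a g))"
  unfolding proximal_flow_def
proof (intro conjI ballI)
  show "flow G T X (\<lambda>g. \<phi> (a g))"
    using pf flow_twist[of G T X \<phi>, OF _ a] by (simp add: proximal_flow_def)
next
  fix x y assume "x \<in> topspace X" "y \<in> topspace X"
  then obtain F z where F: "F \<noteq> bot" "\<forall>\<^sub>F t in F. t \<in> carrier G"
      "limitin X (\<lambda>t. \<phi> t x) z F" "limitin X (\<lambda>t. \<phi> t y) z F"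
    using pf unfolding proximal_flow_def by meson
  define b where "b = inv_into (carrier G) a"
  have bij: "bij_betw a (carrier G) (carrier G)" by (rule topological_autoD(2)[OF a])
  have ab: "a (b t) = t" and bG: "b t \<in> carrier G" if "t \<in> carrier G" for t
    using that bij_betw_inv_into_right[OF bij] bij_betw_apply[OF bij_betw_inv_into[OF bij]]
    by (simp_all add: b_def)
  have lim: "limitin X (\<lambda>t. \<phi> (a t) w) z (filtermap b F)" if "limitin X (\<lambda>t. \<phi> t w) z F" for w
    unfolding limitin_def eventually_filtermap
  proof (intro conjI allI impI)
    show "z \<in> topspace X" using that by (simp add: limitin_def)
    fix U assume "openin X U \<and> z \<in> U"
    then have "\<forall>\<^sub>F t in F. \<phi> t w \<in> U" using that by (simp add: limitin_def)
    \<comment> \<open>The cancellation \<open>a (b t) = t\<close> holds only on the carrier, which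
      \<open>F\<close> eventually stays in.\<close>
    with F(2) show "\<forall>\<^sub>F t in F. \<phi> (a (b t)) w \<in> U"
      by eventually_elim (simp add: ab)
  qed
  have "\<forall>\<^sub>F t in filtermap b F. t \<in> carrier G"
    unfolding eventually_filtermap using F(2) by eventually_elim (rule bG)
  then show "\<exists>F z. F \<noteq> bot \<and> (\<forall>\<^sub>F t in F. t \<in> carrier G) \<and>
      limitin X (\<lambda>t. \<phi> (a t) x) z F \<and> limitin X (\<lambda>t. \<phi> (a t) y) z F"
    using F lim by (metis filtermap_bot_iff)
qed

lemma action_kernel_subgroup:
  assumes "group_action G S \<phi>"
  shows "subgroup {g \<in> carrier G. \<forall>x\<in>S. \<phi> g x = x} G"
proof -
  interpret group_action G S \<phi> by (rule assms)
  interpret group G using group_hom by (rule group_hom.axioms(1))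
  show ?thesis
  proof
    fix g assume "g \<in> {g \<in> carrier G. \<forall>x\<in>S. \<phi> g x = x}"
    then show "inv\<^bsub>G\<^esub> g \<in> {g \<in> carrier G. \<forall>x\<in>S. \<phi> g x = x}"
      by (auto intro: orbit_sym_aux)
  \<comment> \<open>\<open>id_eq_one\<close>, reversed, turns the action of the unit into the
    identity restricted to \<open>S\<close>.\<close>
  qed (auto simp: composition_rule id_eq_one[symmetric])
qed

text \<open>The kernel is the intersection of the point stabilizers, and each stabilizer is the
  preimage of a closed singleton under the continuous map
  \<open>g \<mapsto> \<phi> g x\<close>.\<close>

lemma flow_kernel_closed:
  assumes fl: "flow G T X \<phi>"
  shows "closedin T {g \<in> carrier G. \<forall>x\<in>topspace X. \<phi> g x = x}"
proof -
  have TG: "topspace T = carrier G" and H: "Hausdorff_space X"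
    and cont: "continuous_map (prod_topology T X) X (\<lambda>(t, x). \<phi> t x)"
    using fl by (auto simp: flow_def topological_group_def)
  have ne: "topspace X \<noteq> {}" using fl by (simp add: flow_def)
  have "closedin T {g \<in> carrier G. \<phi> g x = x}" if x: "x \<in> topspace X" for x
  proof -
    have "continuous_map T (prod_topology T X) (\<lambda>g. (g, x))"
      using x by (simp add: continuous_map_pairedI)
    from continuous_map_compose[OF this cont] have "continuous_map T X (\<lambda>g. \<phi> g x)"
      by (simp add: o_def)
    moreover have "closedin X {x}" using H x by (simp add: closedin_Hausdorff_singleton)
    ultimately show ?thesis
      using closedin_continuous_map_preimage[of T X "\<lambda>g. \<phi> g x" "{x}"] by (simp add: TG)
  qed
  \<comment> \<open>Nonemptiness of the space matters: in HOL an empty intersection would be the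
    whole type, not the carrier.\<close>
  then have "closedin T (\<Inter>x\<in>topspace X. {g \<in> carrier G. \<phi> g x = x})"
    using ne by (intro closedin_INT) auto
  moreover have "(\<Inter>x\<in>topspace X. {g \<in> carrier G. \<phi> g x = x})
      = {g \<in> carrier G. \<forall>x\<in>topspace X. \<phi> g x = x}"
    using ne by blast
  ultimately show ?thesis by simp
qed

text \<open>Universality gives a factor map \<open>f\<close> from the flow onto its own twist by
  \<open>a\<close>. If \<open>t\<close> fixes \<open>x\<close>, then
  \<open>f x = f (\<phi> t x) = \<phi> (a t) (f x)\<close>, and every point has the form
  \<open>f x\<close>.\<close>

lemma universal_flow_kernel_characteristic:
  assumes u: "universal_minimal_proximal_flow G T X \<phi>" and a: "a \<in> topological_auto G T"
    and t: "t \<in> carrier G" and triv: "\<forall>x\<in>topspace X. \<phi> t x = x"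
  shows "\<forall>x\<in>topspace X. \<phi> (a t) x = x"
proof -
  have "minimal_proximal_flow G T X (\<lambda>g. \<phi> (a g))"
    using u minimal_flow_twist[of G T X \<phi>, OF _ a] proximal_flow_twist[of G T X \<phi>, OF _ a]
    by (simp add: universal_minimal_proximal_flow_def minimal_proximal_flow_def)
  \<comment> \<open>The twisted flow lives on the type of \<open>X\<close>, so universality for
    flows on arbitrary types is used here.\<close>
  then obtain f where f: "factor_map G X \<phi> X (\<lambda>g. \<phi> (a g)) f"
    using universal_minimal_proximal_flow_factor[OF u] by blast
  show ?thesis
  proof
    fix y assume "y \<in> topspace X"
    then obtain x where "x \<in> topspace X" "y = f x"
      using f unfolding factor_map_def by blast
    then show "\<phi> (a t) y = y"
      using f t triv unfolding factor_map_def by metis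
  qed
qed

text \<open>Each orbit is a single point, which is closed by the Hausdorff property and dense by
  minimality.\<close>

lemma minimal_flow_trivial_action:
  assumes mf: "minimal_flow G T X \<phi>"
    and triv: "\<And>g x. g \<in> carrier G \<Longrightarrow> x \<in> topspace X \<Longrightarrow> \<phi> g x = x"
  shows "\<exists>x. topspace X = {x}"
proof -
  have fl: "flow G T X \<phi>" using mf by (simp add: minimal_flow_def)
  then obtain x where x: "x \<in> topspace X" unfolding flow_def by blast
  have "carrier G \<noteq> {}"
    using fl by (auto simp: flow_def topological_group_def dest: group.is_monoid monoid.one_closed)
  then have "orbit G \<phi> x = {x}" using triv x by (force simp: orbit_def)
  moreover have "X closure_of {x} = {x}"
    using fl x by (simp add: flow_def closure_of_closedin closedin_Hausdorff_singleton)
  ultimately have "topspace X = {x}"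
    using mf x unfolding minimal_flow_def by metis
  then show ?thesis ..
qed

text \<open>This passes universality from a flow to any minimal proximal flow mapping onto
  it.\<close>

lemma factor_map_compose:
  assumes f: "factor_map G X \<phi> Y \<psi> f" and k: "factor_map G Y \<psi> Z \<theta> k"
  shows "factor_map G X \<phi> Z \<theta> (k \<circ> f)"
proof -
  have "continuous_map X Z (k \<circ> f)"
    using f k by (auto simp: factor_map_def intro: continuous_map_compose)
  moreover have "(k \<circ> f) ` topspace X = topspace Z"
    using f k by (simp add: factor_map_def flip: image_image)
  moreover have "k (f (\<phi> t x)) = \<theta> t (k (f x))" if "t \<in> carrier G" "x \<in> topspace X" for t x
  proof -
    have "f x \<in> topspace Y" using f that(2) unfolding factor_map_def by blast
    then show ?thesis using f k that by (simp add: factor_map_def)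
  qed
  ultimately show ?thesis by (simp add: factor_map_def)
qed

text \<open>Strong amenability asks for a one-point universal flow on \<open>'g set set\<close>,
  whereas \<open>X\<close> has an arbitrary type. A copy \<open>Y\<close> on the required type maps
  onto \<open>X\<close>, hence is universal, and is an image of \<open>X\<close>, hence is a
  point.\<close>

lemma strongly_amenable_if_point:
  fixes G :: "('g, 'm) monoid_scheme" and X :: "'x topology"
  assumes u: "universal_minimal_proximal_flow G T X \<phi>" and pt: "topspace X = {x}"
  shows "strongly_amenable G T"
proof -
  have mp: "minimal_proximal_flow G T X \<phi>"
    using u by (simp add: universal_minimal_proximal_flow_def)
  \<comment> \<open>Any constant map is injective on one point; the value \<open>{}\<close> is an
    arbitrary choice.\<close>
  have "inj_on (\<lambda>_. {}) (topspace X)" by (simp add: pt)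
  then obtain Y :: "'g set set topology" and \<psi> k
    where Y: "minimal_proximal_flow G T Y \<psi>" and k: "factor_map G Y \<psi> X \<phi> k"
    using minimal_proximal_flow_transfer[OF mp] by blast
  obtain f where f: "factor_map G X \<phi> Y \<psi> f"
    using universal_minimal_proximal_flow_factor[OF u Y] by blast
  have "topspace Y = {f x}" using f pt by (auto simp: factor_map_def)
  moreover have "universal_minimal_proximal_flow G T Y \<psi>"
    unfolding universal_minimal_proximal_flow_def
    using Y universal_minimal_proximal_flow_factor[OF u] factor_map_compose[OF k] by blast
  ultimately show ?thesis unfolding strongly_amenable_def by blast
qed

theorem corollary2p5:
  fixes G :: "('g, 'm) monoid_scheme" and T :: "'g topology"
    and X :: "'x topology" and \<phi> :: "'g \<Rightarrow> 'x \<Rightarrow> 'x"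
  assumes "topological_group G T"
    and "topologically_characteristically_simple G T"
    and "\<not> strongly_amenable G T"
    and "universal_minimal_proximal_flow G T X \<phi>"
  shows "\<forall>t\<in>carrier G. (\<forall>x\<in>topspace X. \<phi> t x = x) \<longrightarrow> t = \<one>\<^bsub>G\<^esub>"
proof (intro ballI impI, rule ccontr)
  fix t assume t: "t \<in> carrier G" and triv: "\<forall>x\<in>topspace X. \<phi> t x = x" and "t \<noteq> \<one>\<^bsub>G\<^esub>"
  define K where "K = {g \<in> carrier G. \<forall>x\<in>topspace X. \<phi> g x = x}"
  define A where "A = {a t | a. a \<in> topological_auto G T}"
  have mf: "minimal_flow G T X \<phi>" and fl: "flow G T X \<phi>"
    using assms(4)
    by (auto simp: universal_minimal_proximal_flow_def minimal_proximal_flow_def minimal_flow_def)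
  have "A \<subseteq> K"
  proof
    fix s assume "s \<in> A"
    then obtain a where a: "a \<in> topological_auto G T" and s: "s = a t" by (auto simp: A_def)
    have "a t \<in> carrier G" using topological_autoD(1)[OF a] t by (auto simp: hom_def)
    then show "s \<in> K"
      using universal_flow_kernel_characteristic[OF assms(4) a t triv] by (simp add: K_def s)
  qed
  moreover have "subgroup K G"
    unfolding K_def using fl by (auto simp: flow_def intro: action_kernel_subgroup)
  moreover have "group G" using assms(1) by (simp add: topological_group_def)
  ultimately have "generate G A \<subseteq> K" by (simp add: group.generate_subgroup_incl)
  then have "T closure_of generate G A \<subseteq> K"
    unfolding K_def using flow_kernel_closed[OF fl] by (rule closure_of_minimal)
  moreover have "T closure_of generate G A = carrier G"
    using assms(2) t \<open>t \<noteq> \<one>\<^bsub>G\<^esub>\<close>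
    unfolding topologically_characteristically_simple_def A_def by blast
  \<comment> \<open>The kernel \<open>K\<close> now contains all of \<open>G\<close>, so the action
    is trivial.\<close>
  ultimately have "\<exists>x. topspace X = {x}"
    by (intro minimal_flow_trivial_action[OF mf]) (auto simp: K_def)
  then show False using strongly_amenable_if_point[OF assms(4)] assms(3) by blast
qed

end
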